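(* $\dim_{\mathbb{k}} \mathrm{Cl}_q(n,k) = (8k)^n$.
   Context: Let $\mathbb{k}$ be a field of characteristic different from $2$, let $q\in\mathbb{k}^\times$, and let $n,k$ be positive integers. The quantum Clifford algebra $\mathrm{Cl}_q(n,k)$ is the unital associative $\mathbb{k}$-algebra generated by $\psi_a,\psi_a^*,\omega_a,\omega_a^{-1}$ for $a\in\{1,\dots,n\}$, subject to the relations (for all $a,b\in\{1,\dots,n\}$): $\omega_a\omega_b=\omega_b\omega_a$; $\omega_a\omega_a^{-1}=1$; $\omega_a\psi_b=q^{\delta_{ab}}\psi_b\omega_a$; $\omega_a\psi_b^*=q^{-\delta_{ab}}\psi_b^*\omega_a$; $\psi_a\psi_b+\psi_b\psi_a=0$; $\psi_a^*\psi_b^*+\psi_b^*\psi_a^*=0$; $\psi_a\psi_a^*+q^k\psi_a^*\psi_a=\omega_a^{-k}$; $\psi_a\psi_a^*+q^{-k}\psi_a^*\psi_a=\omega_a^{k}$; and $\psi_a\psi_b^*+\psi_b^*\psi_a=0$ if $a\neq b$. *)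

theory Defs
  imports Main
begin

text \<open>The free associative algebra over a field on the generators
  psi_a, psi_a^*, omega_a, omega_a^{-1} (a in {1..n}) is modelled concretely:
  elements are finitely supported coefficient functions on words (lists of
  generators), multiplication is concatenation extended bilinearly.\<close>

datatype gen = Psi nat | PsiS nat | Om nat | OmI nat

fun gen_idx :: "gen \<Rightarrow> nat" where
  "gen_idx (Psi a) = a" | "gen_idx (PsiS a) = a" | "gen_idx (Om a) = a" | "gen_idx (OmI a) = a"

definition Gens :: "nat \<Rightarrow> gen set" where
  "Gens n = {g. gen_idx g \<in> {1..n}}"

type_synonym 'a falg = "gen list \<Rightarrow> 'a"

definition FA :: "nat \<Rightarrow> ('a::field) falg set" where
  "FA n = {f. finite {w. f w \<noteq> 0} \<and> (\<forall>w. f w \<noteq> 0 \<longrightarrow> set w \<subseteq> Gens n)}"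

definition fzero :: "('a::field) falg" where "fzero = (\<lambda>_. 0)"
definition fone :: "('a::field) falg" where "fone = (\<lambda>w. if w = [] then 1 else 0)"
definition fgen :: "gen \<Rightarrow> ('a::field) falg" where "fgen g = (\<lambda>w. if w = [g] then 1 else 0)"
definition fadd :: "('a::field) falg \<Rightarrow> 'a falg \<Rightarrow> 'a falg" where "fadd f g = (\<lambda>w. f w + g w)"
definition fsub :: "('a::field) falg \<Rightarrow> 'a falg \<Rightarrow> 'a falg" where "fsub f g = (\<lambda>w. f w - g w)"
definition fsmul :: "'a::field \<Rightarrow> 'a falg \<Rightarrow> 'a falg" where "fsmul c f = (\<lambda>w. c * f w)"
definition fmul :: "('a::field) falg \<Rightarrow> 'a falg \<Rightarrow> 'a falg" where
  "fmul f g = (\<lambda>w. \<Sum>i\<le>length w. f (take i w) * g (drop i w))"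
definition fpow :: "('a::field) falg \<Rightarrow> nat \<Rightarrow> 'a falg" where
  "fpow f m = ((fmul f) ^^ m) fone"

inductive_set ideal_gen :: "nat \<Rightarrow> ('a::field) falg set \<Rightarrow> 'a falg set" for n R where
  base: "r \<in> R \<Longrightarrow> r \<in> ideal_gen n R"
| zero: "fzero \<in> ideal_gen n R"
| add: "x \<in> ideal_gen n R \<Longrightarrow> y \<in> ideal_gen n R \<Longrightarrow> fadd x y \<in> ideal_gen n R"
| smul: "x \<in> ideal_gen n R \<Longrightarrow> fsmul c x \<in> ideal_gen n R"
| lmul: "x \<in> ideal_gen n R \<Longrightarrow> f \<in> FA n \<Longrightarrow> fmul f x \<in> ideal_gen n R"
| rmul: "x \<in> ideal_gen n R \<Longrightarrow> f \<in> FA n \<Longrightarrow> fmul x f \<in> ideal_gen n R"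

definition Cl_rels :: "'a::field \<Rightarrow> nat \<Rightarrow> nat \<Rightarrow> 'a falg set" where
  "Cl_rels q n k =
    (let \<psi> = (\<lambda>a. fgen (Psi a)); \<psi>s = (\<lambda>a. fgen (PsiS a));
         \<omega> = (\<lambda>a. fgen (Om a)); \<omega>i = (\<lambda>a. fgen (OmI a));
         \<delta> = (\<lambda>a b::nat. if a = b then 1 else (0::nat)) in
    (\<Union>a\<in>{1..n}. \<Union>b\<in>{1..n}.
      { fsub (fmul (\<omega> a) (\<omega> b)) (fmul (\<omega> b) (\<omega> a)),
        fsub (fmul (\<omega> a) (\<omega>i a)) fone,
        fsub (fmul (\<omega>i a) (\<omega> a)) fone,
        fsub (fmul (\<omega> a) (\<psi> b)) (fsmul (q ^ \<delta> a b) (fmul (\<psi> b) (\<omega> a))),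
        fsub (fmul (\<omega> a) (\<psi>s b)) (fsmul (inverse q ^ \<delta> a b) (fmul (\<psi>s b) (\<omega> a))),
        fadd (fmul (\<psi> a) (\<psi> b)) (fmul (\<psi> b) (\<psi> a)),
        fadd (fmul (\<psi>s a) (\<psi>s b)) (fmul (\<psi>s b) (\<psi>s a)),
        fsub (fadd (fmul (\<psi> a) (\<psi>s a)) (fsmul (q ^ k) (fmul (\<psi>s a) (\<psi> a)))) (fpow (\<omega>i a) k),
        fsub (fadd (fmul (\<psi> a) (\<psi>s a)) (fsmul (inverse q ^ k) (fmul (\<psi>s a) (\<psi> a)))) (fpow (\<omega> a) k) }
      \<union> (if a \<noteq> b then { fadd (fmul (\<psi> a) (\<psi>s b)) (fmul (\<psi>s b) (\<psi> a)) } else {})))"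

definition Cl_ideal :: "'a::field \<Rightarrow> nat \<Rightarrow> nat \<Rightarrow> 'a falg set" where
  "Cl_ideal q n k = ideal_gen n (Cl_rels q n k)"

definition quotient_dim_eq :: "nat \<Rightarrow> ('a::field) falg set \<Rightarrow> nat \<Rightarrow> bool" where
  "quotient_dim_eq n I d \<longleftrightarrow>
    (\<exists>B. finite B \<and> B \<subseteq> FA n \<and> card B = d
      \<and> (\<forall>c. (\<lambda>w. \<Sum>b\<in>B. c b * b w) \<in> I \<longrightarrow> (\<forall>b\<in>B. c b = 0))
      \<and> (\<forall>f\<in>FA n. \<exists>c. fsub f (\<lambda>w. \<Sum>b\<in>B. c b * b w) \<in> I))"

end

theory Submission
  imports Defs "HOL-Library.FuncSet"
begin

text \<open>For \<open>n = 1\<close> the algebra is \<open>M\<^sub>2(R)\<close> over the ground field \<open>F\<close>, \<open>R = F[x]/(x\<^sup>2\<^sup>k - 1)\<close>, via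
  \<open>\<omega> = diag(x, q\<^sup>-\<^sup>1 x)\<close>, \<open>\<psi> = E\<^sub>1\<^sub>2\<close>, \<open>\<psi>\<^sup>* = x\<^sup>k E\<^sub>2\<^sub>1\<close>, which has dimension \<open>4 \<cdot> 2k\<close>; in general
  it is a super tensor product of \<open>n\<close> such factors. The words \<open>h \<omega>\<^sup>j\<close> with
  \<open>h \<in> {\<psi>, \<psi>\<^sup>*, \<psi>\<psi>\<^sup>*, \<psi>\<^sup>*\<psi>}\<close> and \<open>j < 2k\<close> act as unit multiples of \<open>x\<^sup>i E\<^sub>r\<^sub>s\<close>, so their products over
  the \<open>n\<close> factors are independent. They span because \<open>\<psi>\<psi>\<^sup>*\<psi> = \<omega>\<^sup>k\<psi> = \<omega>\<^sup>-\<^sup>k\<psi>\<close> (and likewise for \<open>\<psi>\<^sup>*\<close>)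
  makes \<open>\<omega>\<^sup>2\<^sup>k\<close> act on each of them as a scalar, and \<open>1 = (\<psi>\<psi>\<^sup>* + q\<^sup>k \<psi>\<^sup>*\<psi>) \<omega>\<^sup>k\<close>.\<close>

section \<open>The free algebra\<close>

definition fword :: "gen list \<Rightarrow> ('a::field) falg" where
  "fword u = (\<lambda>w. if w = u then 1 else 0)"

text \<open>Finiteness makes the sum in \<open>act_alg\<close> additive in the algebra element; over
  an infinite support it would default to 0.\<close>

definition fin_supp :: "('a::field) falg \<Rightarrow> bool" where
  "fin_supp f \<longleftrightarrow> finite {w. f w \<noteq> 0}"

lemma fgen_eq_fword: "fgen g = fword [g]"
  by (simp add: fgen_def fword_def)

lemma fone_eq_fword: "fone = fword []"
  by (simp add: fone_def fword_def)

text \<open>Among all cuts of a word only the one at \<open>length u\<close> can yield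
  \<open>u\<close> and \<open>v\<close>, so the convolution has at most one nonzero term.\<close>

lemma fmul_fword: "fmul (fword u) (fword v) = (fword (u @ v) :: ('a::field) falg)"
proof
  fix w
  have split_iff: "take i w = u \<and> drop i w = v \<longleftrightarrow> i = length u \<and> w = u @ v"
    if "i \<le> length w" for i
    using that append_take_drop_id[of i w] by fastforce
  have "fmul (fword u) (fword v) w =
      (\<Sum>i\<le>length w. if take i w = u \<and> drop i w = v then 1 else (0::'a))"
    unfolding fmul_def fword_def by (intro sum.cong refl) simp
  also have "\<dots> = (\<Sum>i\<le>length w. if i = length u \<and> w = u @ v then 1 else 0)"
    by (intro sum.cong refl) (simp only: split_iff atMost_iff)
  also have "\<dots> = fword (u @ v) w"
    by (auto simp: fword_def)
  finally show "fmul (fword u) (fword v) w = (fword (u @ v) w :: 'a)" .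
qed

lemma fpow_fgen: "fpow (fgen g) m = fword (replicate m g)"
  by (induction m) (simp_all add: fpow_def fone_eq_fword fgen_eq_fword fmul_fword)

lemma fmul_fadd_left: "fmul (fadd f g) h = fadd (fmul f h) (fmul g h)"
  by (simp add: fmul_def fadd_def fun_eq_iff algebra_simps sum.distrib)

lemma fmul_fadd_right: "fmul h (fadd f g) = fadd (fmul h f) (fmul h g)"
  by (simp add: fmul_def fadd_def fun_eq_iff algebra_simps sum.distrib)

lemma fmul_fsmul_left: "fmul (fsmul c f) h = fsmul c (fmul f h)"
  by (simp add: fmul_def fsmul_def fun_eq_iff algebra_simps sum_distrib_left)

lemma fmul_fsmul_right: "fmul h (fsmul c f) = fsmul c (fmul h f)"
  by (simp add: fmul_def fsmul_def fun_eq_iff algebra_simps sum_distrib_left)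

lemma fsub_eq: "fsub f g = fadd f (fsmul (-1) g)"
  by (simp add: fsub_def fadd_def fsmul_def)

lemma fword_in_FA: "set u \<subseteq> Gens n \<Longrightarrow> fword u \<in> FA n"
  by (auto simp: FA_def fword_def)

lemma fin_supp_fword [simp]: "fin_supp (fword u)"
  by (simp add: fin_supp_def fword_def)

lemma fin_supp_fzero [simp]: "fin_supp fzero"
  by (simp add: fin_supp_def fzero_def)

lemma fin_supp_fadd [simp]: "fin_supp f \<Longrightarrow> fin_supp g \<Longrightarrow> fin_supp (fadd f g)"
  unfolding fin_supp_def fadd_def
  by (rule finite_subset[of _ "{w. f w \<noteq> 0} \<union> {w. g w \<noteq> 0}"]) auto

lemma fin_supp_fsmul [simp]: "fin_supp f \<Longrightarrow> fin_supp (fsmul c f)"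
  unfolding fin_supp_def fsmul_def by (rule finite_subset[of _ "{w. f w \<noteq> 0}"]) auto

lemma fmul_supp: "{w. fmul f g w \<noteq> 0} \<subseteq> (\<lambda>(u, v). u @ v) ` ({w. f w \<noteq> 0} \<times> {w. g w \<noteq> 0})"
proof
  fix w assume "w \<in> {w. fmul f g w \<noteq> 0}"
  then have "(\<Sum>i\<le>length w. f (take i w) * g (drop i w)) \<noteq> 0"
    by (simp add: fmul_def)
  then obtain i where "f (take i w) * g (drop i w) \<noteq> 0"
    by (meson sum.neutral)
  then show "w \<in> (\<lambda>(u, v). u @ v) ` ({w. f w \<noteq> 0} \<times> {w. g w \<noteq> 0})"
    by (intro image_eqI[of _ _ "(take i w, drop i w)"]) auto
qed

lemma fin_supp_fmul [simp]: "fin_supp f \<Longrightarrow> fin_supp g \<Longrightarrow> fin_supp (fmul f g)"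
  using finite_subset[OF fmul_supp] by (auto simp: fin_supp_def)

lemma fin_supp_FA: "f \<in> FA n \<Longrightarrow> fin_supp f"
  by (simp add: FA_def fin_supp_def)

text \<open>Products and powers of generators collapse to single words. In this form the relations
  are checked on the representation and used as rewrite rules.\<close>

lemma Cl_rels_words:
  "Cl_rels q n k = (\<Union>a\<in>{1..n}. \<Union>b\<in>{1..n}.
    { fsub (fword [Om a, Om b]) (fword [Om b, Om a]),
      fsub (fword [Om a, OmI a]) (fword []),
      fsub (fword [OmI a, Om a]) (fword []),
      fsub (fword [Om a, Psi b]) (fsmul (q ^ (if a = b then 1 else 0)) (fword [Psi b, Om a])),
      fsub (fword [Om a, PsiS b]) (fsmul (inverse q ^ (if a = b then 1 else 0)) (fword [PsiS b, Om a])),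
      fadd (fword [Psi a, Psi b]) (fword [Psi b, Psi a]),
      fadd (fword [PsiS a, PsiS b]) (fword [PsiS b, PsiS a]),
      fsub (fadd (fword [Psi a, PsiS a]) (fsmul (q ^ k) (fword [PsiS a, Psi a]))) (fword (replicate k (OmI a))),
      fsub (fadd (fword [Psi a, PsiS a]) (fsmul (inverse q ^ k) (fword [PsiS a, Psi a]))) (fword (replicate k (Om a))) }
    \<union> (if a \<noteq> b then { fadd (fword [Psi a, PsiS b]) (fword [PsiS b, Psi a]) } else {}))"
  unfolding Cl_rels_def Let_def fpow_fgen
  by (simp only: fgen_eq_fword fone_eq_fword fmul_fword append.simps)

lemma fin_supp_Cl_rels: "r \<in> Cl_rels q n k \<Longrightarrow> fin_supp r"
  unfolding Cl_rels_words fsub_eq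
  by (elim UN_E UnE insertE emptyE; simp split: if_splits)

section \<open>A representation by matrix units\<close>

text \<open>The Jordan-Wigner sign: it makes odd operators of different tensor factors
  anticommute.\<close>

definition jw_sign :: "nat \<Rightarrow> nat set \<Rightarrow> 'a::field" where
  "jw_sign a S = (-1) ^ card {b\<in>S. b < a}"

text \<open>Membership of \<open>a\<close> in the set selects the row in factor \<open>a\<close>;
  \<open>m a\<close> is a position on which the variable x of that factor acts as a shift.\<close>

type_synonym 'a fock = "nat set \<Rightarrow> (nat \<Rightarrow> int) \<Rightarrow> 'a"

text \<open>A matrix unit with row r and column s gives the result at r the value of the vector at
  s; the first row is \<open>a \<notin> S\<close>. Adding 1 to \<open>m a\<close> is multiplication
  by x, so the shift by k in \<open>PsiS\<close> is the factor x^k.\<close>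

fun act :: "'a::field \<Rightarrow> nat \<Rightarrow> gen \<Rightarrow> 'a fock \<Rightarrow> 'a fock" where
  "act q k (Psi a) h S m = (if a \<in> S then 0 else jw_sign a S * h (insert a S) m)"
| "act q k (PsiS a) h S m =
    (if a \<in> S then jw_sign a S * h (S - {a}) (m(a := m a + int k)) else 0)"
| "act q k (Om a) h S m = (if a \<in> S then inverse q else 1) * h S (m(a := m a + 1))"
| "act q k (OmI a) h S m = (if a \<in> S then q else 1) * h S (m(a := m a - 1))"

definition act_word :: "'a::field \<Rightarrow> nat \<Rightarrow> gen list \<Rightarrow> 'a fock \<Rightarrow> 'a fock" where
  "act_word q k w = foldr (act q k) w"

definition act_alg :: "'a::field \<Rightarrow> nat \<Rightarrow> 'a falg \<Rightarrow> 'a fock \<Rightarrow> 'a fock" where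
  "act_alg q k f h = (\<lambda>S m. \<Sum>w | f w \<noteq> 0. f w * act_word q k w h S m)"

text \<open>On periodic functions the shifts of a coordinate of \<open>m\<close> realise the group algebra of
  \<open>\<int>/2k\<close>.\<close>

definition periodic :: "nat \<Rightarrow> 'a fock \<Rightarrow> bool" where
  "periodic k h \<longleftrightarrow> (\<forall>S m a. h S (m(a := m a + 2 * int k)) = h S m)"

lemma jw_sign_square [simp]: "jw_sign a S * jw_sign a S = 1"
  by (simp add: jw_sign_def flip: power_mult_distrib)

lemma jw_sign_square_assoc [simp]: "jw_sign a S * (jw_sign a S * x) = x"
  by (simp flip: mult.assoc)

lemma jw_sign_nonzero [simp]: "jw_sign a S \<noteq> 0"
  by (simp add: jw_sign_def)

lemma jw_sign_insert:
  "jw_sign a (insert b S) = (if b < a \<and> b \<notin> S then - jw_sign a S else jw_sign a S)"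
proof -
  have "{c \<in> insert b S. c < a} = (if b < a then insert b {c\<in>S. c < a} else {c\<in>S. c < a})"
    by auto
  then show ?thesis
    by (auto simp: jw_sign_def card_insert_if)
qed

lemma jw_sign_remove:
  "(jw_sign a (S - {b}) :: 'a::field) = (if b < a \<and> b \<in> S then - jw_sign a S else jw_sign a S)"
proof (cases "b \<in> S")
  case True
  then show ?thesis
    using jw_sign_insert[of a b "S - {b}", where 'a = 'a] by (auto simp: insert_absorb)
qed simp

lemma act_word_Nil [simp]: "act_word q k [] h = h"
  by (simp add: act_word_def)

lemma act_word_Cons [simp]: "act_word q k (g # w) h = act q k g (act_word q k w h)"
  by (simp add: act_word_def)

lemma act_word_append: "act_word q k (u @ v) h = act_word q k u (act_word q k v h)"
  by (simp add: act_word_def)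

lemma act_sum:
  "act q k g (\<lambda>S m. \<Sum>i\<in>A. c i * H i S m) = (\<lambda>S m. \<Sum>i\<in>A. c i * act q k g (H i) S m)"
  by (intro ext, cases g) (auto simp: sum_distrib_left algebra_simps)

lemma act_word_sum:
  "act_word q k w (\<lambda>S m. \<Sum>i\<in>A. c i * H i S m) = (\<lambda>S m. \<Sum>i\<in>A. c i * act_word q k w (H i) S m)"
  by (induction w) (simp_all add: act_sum)

lemma act_alg_superset:
  assumes "finite A" "{w. f w \<noteq> 0} \<subseteq> A"
  shows "act_alg q k f h S m = (\<Sum>w\<in>A. f w * act_word q k w h S m)"
  unfolding act_alg_def using assms by (intro sum.mono_neutral_left) auto

lemma act_alg_fword [simp]: "act_alg q k (fword u) h = act_word q k u h"
proof (intro ext)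
  fix S m
  show "act_alg q k (fword u) h S m = act_word q k u h S m"
    using act_alg_superset[of "{u}" "fword u" q k h S m] by (auto simp: fword_def)
qed

lemma act_alg_fzero [simp]: "act_alg q k fzero h S m = 0"
  by (simp add: act_alg_def fzero_def)

lemma act_alg_fadd [simp]:
  assumes "fin_supp f" "fin_supp g"
  shows "act_alg q k (fadd f g) h S m = act_alg q k f h S m + act_alg q k g h S m"
proof -
  let ?A = "{w. f w \<noteq> 0} \<union> {w. g w \<noteq> 0}"
  have "finite ?A" using assms by (simp add: fin_supp_def)
  moreover have "{w. fadd f g w \<noteq> 0} \<subseteq> ?A" by (auto simp: fadd_def)
  ultimately show ?thesis
    by (simp add: act_alg_superset[of ?A] fadd_def sum.distrib algebra_simps)
qed

lemma act_alg_fsmul [simp]: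
  assumes "fin_supp f"
  shows "act_alg q k (fsmul c f) h S m = c * act_alg q k f h S m"
proof -
  have "finite {w. f w \<noteq> 0}" using assms by (simp add: fin_supp_def)
  then have "act_alg q k (fsmul c f) h S m =
      (\<Sum>w | f w \<noteq> 0. fsmul c f w * act_word q k w h S m)"
    by (rule act_alg_superset) (auto simp: fsmul_def)
  then show ?thesis
    by (simp add: act_alg_def fsmul_def sum_distrib_left algebra_simps)
qed

text \<open>A word with a cut position amounts to a pair of words, which turns the convolution into
  a double sum.\<close>

lemma act_alg_fmul:
  assumes "fin_supp f" "fin_supp g"
  shows "act_alg q k (fmul f g) h = act_alg q k f (act_alg q k g h)"
proof (intro ext)
  fix S m
  let ?F = "{w. f w \<noteq> 0}" and ?G = "{w. g w \<noteq> 0}"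
  define A where "A = (\<lambda>(u, v). u @ v) ` (?F \<times> ?G)"
  let ?P = "{(u, v). u @ v \<in> A}"
  let ?t = "\<lambda>u v. f u * g v * act_word q k (u @ v) h S m"
  have fin: "finite ?F" "finite ?G" "finite A"
    using assms by (auto simp: fin_supp_def A_def)
  have "act_alg q k (fmul f g) h S m = (\<Sum>w\<in>A. fmul f g w * act_word q k w h S m)"
    by (rule act_alg_superset) (use fin fmul_supp in \<open>auto simp: A_def\<close>)
  also have "\<dots> = (\<Sum>w\<in>A. \<Sum>i\<le>length w. ?t (take i w) (drop i w))"
    by (simp add: fmul_def sum_distrib_right)
  also have "\<dots> = (\<Sum>(w, i)\<in>Sigma A (\<lambda>w. {..length w}). ?t (take i w) (drop i w))"
    using fin by (subst sum.Sigma) auto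
  also have "\<dots> = (\<Sum>(u, v)\<in>?P. ?t u v)"
    by (rule sum.reindex_bij_witness[of _ "\<lambda>(u, v). (u @ v, length u)" "\<lambda>(w, i). (take i w, drop i w)"])
       auto
  also have "\<dots> = (\<Sum>(u, v)\<in>?F \<times> ?G. ?t u v)"
  \<comment> \<open>A pair outside the product of the supports may still concatenate to an element
    of \<open>A\<close>, but then \<open>f u * g v\<close> vanishes.\<close>
  proof (rule sum.mono_neutral_right)
    have "?P \<subseteq> (\<lambda>(w, i). (take i w, drop i w)) ` Sigma A (\<lambda>w. {..length w})"
    proof
      fix p assume "p \<in> ?P"
      then show "p \<in> (\<lambda>(w, i). (take i w, drop i w)) ` Sigma A (\<lambda>w. {..length w})"
        by (intro image_eqI[of _ _ "(fst p @ snd p, length (fst p))"]) (auto split: prod.splits)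
    qed
    then show "finite ?P" by (rule finite_subset) (use fin in auto)
  qed (auto simp: A_def)
  also have "\<dots> = (\<Sum>u\<in>?F. \<Sum>v\<in>?G. f u * (g v * act_word q k u (act_word q k v h) S m))"
    by (subst sum.Sigma[symmetric]) (use fin in \<open>auto simp: act_word_append mult.assoc\<close>)
  also have "\<dots> = act_alg q k f (act_alg q k g h) S m"
    by (simp add: act_alg_def act_word_sum sum_distrib_left)
  finally show "act_alg q k (fmul f g) h S m = act_alg q k f (act_alg q k g h) S m" .
qed

lemma periodic_act: "periodic k h \<Longrightarrow> periodic k (act q k g h)"
  unfolding periodic_def
proof (intro allI)
  fix S m a
  assume *: "\<forall>S m a. h S (m(a := m a + 2 * int k)) = h S m"
  have shift: "h S' (m(a := m a + 2 * int k, b := (m(a := m a + 2 * int k)) b + x)) =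
      h S' (m(b := m b + x))" for S' b x
    using *[rule_format, of S' "m(b := m b + x)" a]
    by (cases "a = b") (simp_all add: fun_upd_twist algebra_simps)
  show "act q k g h S (m(a := m a + 2 * int k)) = act q k g h S m"
    using shift[of _ _ "-1"] by (cases g) (simp_all only: act.simps shift * diff_conv_add_uminus)
qed

lemma periodic_act_word: "periodic k h \<Longrightarrow> periodic k (act_word q k w h)"
  by (induction w) (simp_all add: periodic_act)

lemma periodic_act_alg: "periodic k h \<Longrightarrow> periodic k (act_alg q k f h)"
  using periodic_act_word[of k h q] by (simp add: periodic_def act_alg_def)

section \<open>The defining relations hold in the representation\<close>

lemma act_word_replicate_Om:
  "act_word q k (replicate j (Om a)) h S m =
    (if a \<in> S then inverse q else 1) ^ j * h S (m(a := m a + int j))"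
  by (induction j arbitrary: m) (auto simp: algebra_simps)

lemma act_word_replicate_OmI:
  "act_word q k (replicate j (OmI a)) h S m =
    (if a \<in> S then q else 1) ^ j * h S (m(a := m a - int j))"
  by (induction j arbitrary: m) (auto simp: algebra_simps)

lemma periodic_half:
  assumes "periodic k h"
  shows "h S (m(a := m a - int k)) = h S (m(a := m a + int k))"
  using assms[unfolded periodic_def, rule_format, of S "m(a := m a - int k)" a]
  by (simp add: algebra_simps)

lemma act_Om_commute: "act q k (Om a) (act q k (Om b) h) S m = act q k (Om b) (act q k (Om a) h) S m"
  by (cases "a = b") (simp_all add: fun_upd_twist)

lemma act_Om_Psi:
  "q \<noteq> 0 \<Longrightarrow> act q k (Om a) (act q k (Psi b) h) S m =
    q ^ (if a = b then 1 else 0) * act q k (Psi b) (act q k (Om a) h) S m"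
  by (cases "a = b") simp_all

lemma act_Om_PsiS:
  "act q k (Om a) (act q k (PsiS b) h) S m =
    inverse q ^ (if a = b then 1 else 0) * act q k (PsiS b) (act q k (Om a) h) S m"
  by (cases "a = b") (simp_all add: fun_upd_twist algebra_simps)

lemma act_Psi_Psi:
  "act q k (Psi a) (act q k (Psi b) h) S m + act q k (Psi b) (act q k (Psi a) h) S m = 0"
  by (cases "a < b"; cases "a = b") (auto simp: jw_sign_insert insert_commute[of a b])

lemma act_PsiS_PsiS:
  "act q k (PsiS a) (act q k (PsiS b) h) S m + act q k (PsiS b) (act q k (PsiS a) h) S m = 0"
proof -
  have "S - {a} - {b} = S - {b} - {a}" by blast
  then show ?thesis
    by (cases "a < b"; cases "a = b") (auto simp: jw_sign_remove fun_upd_twist)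
qed

lemma act_Psi_PsiS:
  assumes "a \<noteq> b"
  shows "act q k (Psi a) (act q k (PsiS b) h) S m + act q k (PsiS b) (act q k (Psi a) h) S m = 0"
proof -
  have "insert a S - {b} = insert a (S - {b})" using assms by blast
  then show ?thesis
    using assms by (cases "a < b") (auto simp: jw_sign_remove jw_sign_insert)
qed

text \<open>On each row at most one of the two products survives, and it shifts by k. Powers of
  \<open>OmI a\<close> shift by -k instead; periodicity, that is x^k = x^(-k), reconciles the
  two.\<close>

lemma act_Cl_rels_square:
  assumes "periodic k h"
  shows "act q k (Psi a) (act q k (PsiS a) h) S m + q ^ k * act q k (PsiS a) (act q k (Psi a) h) S m
      = act_word q k (replicate k (OmI a)) h S m"
    and "act q k (Psi a) (act q k (PsiS a) h) S m + inverse q ^ k * act q k (PsiS a) (act q k (Psi a) h) S m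
      = act_word q k (replicate k (Om a)) h S m"
  using periodic_half[OF assms, of S m a]
  by (auto simp: act_word_replicate_Om act_word_replicate_OmI jw_sign_insert jw_sign_remove insert_absorb)

lemma act_alg_Cl_rels:
  assumes "r \<in> Cl_rels q n k" "q \<noteq> 0" "periodic k h"
  shows "act_alg q k r h S m = 0"
proof -
  have inverses: "act q k (Om a) (act q k (OmI a) h) S m = h S m"
    "act q k (OmI a) (act q k (Om a) h) S m = h S m" for a
    using assms(2) by auto
  show ?thesis
    using assms(1) unfolding Cl_rels_words fsub_eq
    by (elim UN_E UnE insertE emptyE)
       (simp_all add: act_Om_commute act_Psi_Psi act_PsiS_PsiS act_Psi_PsiS inverses
          act_Cl_rels_square[OF assms(3)] act_Om_Psi[OF assms(2)] act_Om_PsiS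
          del: act.simps split: if_splits)
qed

text \<open>Finite support is carried through the induction because multiplicativity of the action
  needs it. The vector \<open>h\<close> is generalised because a right factor replaces it by its
  image, which is again periodic.\<close>

lemma act_alg_Cl_ideal:
  assumes "x \<in> Cl_ideal q n k" "q \<noteq> 0" "periodic k h"
  shows "fin_supp x \<and> act_alg q k x h S m = 0"
  using assms(1,3) unfolding Cl_ideal_def
proof (induction arbitrary: h S m rule: ideal_gen.induct)
  case (base r)
  then show ?case using fin_supp_Cl_rels act_alg_Cl_rels assms(2) by blast
next
  case (lmul x f)
  have "act_alg q k x h = (\<lambda>S m. 0)"
    using lmul by (intro ext) blast
  then show ?case
    \<comment> \<open>The instance with the empty index set says that words send the zero function
      to itself.\<close>
    using lmul fin_supp_FA[OF lmul.hyps(2)] act_word_sum[of q k _ "\<lambda>_. 0" _ "{}"]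
    by (auto simp: act_alg_fmul) (simp add: act_alg_def)
next
  case (rmul x f)
  then show ?case
    using fin_supp_FA[OF rmul.hyps(2)] periodic_act_alg[of k h q f] by (auto simp: act_alg_fmul)
qed auto

section \<open>Normal words\<close>

text \<open>In the representation above, \<open>head a s s'\<close> is a monomial multiple of the matrix unit
  \<open>E s s'\<close> in the \<open>a\<close>-th tensor factor.\<close>

fun head :: "nat \<Rightarrow> bool \<Rightarrow> bool \<Rightarrow> gen list" where
  "head a False True = [Psi a]"
| "head a True False = [PsiS a]"
| "head a False False = [Psi a, PsiS a]"
| "head a True True = [PsiS a, Psi a]"

type_synonym bindex = "bool \<times> bool \<times> nat"

fun block :: "nat \<Rightarrow> bindex \<Rightarrow> gen list" where
  "block a (s, s', j) = head a s s' @ replicate j (Om a)"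

fun normal_word :: "nat \<Rightarrow> (nat \<Rightarrow> bindex) \<Rightarrow> gen list" where
  "normal_word 0 I = []"
| "normal_word (Suc n) I = normal_word n I @ block (Suc n) (I (Suc n))"

text \<open>The exponent of x carried by a block: among the four heads only \<open>[Psi a]\<close>
  lacks the factor x^k.\<close>

fun block_shift :: "nat \<Rightarrow> bindex \<Rightarrow> int" where
  "block_shift k (s, s', j) = int j + (if \<not> s \<and> s' then 0 else int k)"

abbreviation set_bit :: "nat \<Rightarrow> bool \<Rightarrow> nat set \<Rightarrow> nat set" where
  "set_bit a s S \<equiv> (if s then insert a S else S - {a})"

text \<open>The scalar \<open>e\<close> is a sign when the head has length one, times q^(-j) when
  the powers of \<omega> act on the second row. It is independent of \<open>h\<close>, so blocks can
  be composed.\<close>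

lemma act_word_block:
  assumes "q \<noteq> 0"
  shows "\<exists>e. e \<noteq> 0 \<and> (\<forall>h. act_word q k (block a i) h S m =
    (if (a \<in> S) = fst i then e * h (set_bit a (fst (snd i)) S) (m(a := m a + block_shift k i)) else 0))"
proof (cases i)
  case (fields s s' j)
  show ?thesis
    unfolding fields
    by (cases s; cases s')
       (auto simp: act_word_append act_word_replicate_Om jw_sign_insert jw_sign_remove insert_absorb
          assms algebra_simps intro: exI[of _ "jw_sign a S * inverse q ^ j"]
          exI[of _ "inverse q ^ j"] exI[of _ "jw_sign a S"] exI[of _ 1])
qed

definition out_set :: "nat \<Rightarrow> (nat \<Rightarrow> bindex) \<Rightarrow> nat set \<Rightarrow> nat set" where
  "out_set n I S = (S - {1..n}) \<union> {a\<in>{1..n}. fst (snd (I a))}"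

definition out_shift :: "nat \<Rightarrow> nat \<Rightarrow> (nat \<Rightarrow> bindex) \<Rightarrow> (nat \<Rightarrow> int) \<Rightarrow> nat \<Rightarrow> int" where
  "out_shift k n I m = (\<lambda>a. if a \<in> {1..n} then m a + block_shift k (I a) else m a)"

lemma act_word_normal_word:
  assumes "q \<noteq> 0"
  shows "\<exists>e. e \<noteq> 0 \<and> (\<forall>h. act_word q k (normal_word n I) h S m =
    (if \<forall>a\<in>{1..n}. (a \<in> S) = fst (I a) then e * h (out_set n I S) (out_shift k n I m) else 0))"
proof (induction n)
  case 0
  then show ?case by (auto simp: out_set_def out_shift_def intro!: exI[of _ 1])
next
  case (Suc n)
  then obtain e where e: "e \<noteq> 0" "\<And>h. act_word q k (normal_word n I) h S m =
    (if \<forall>a\<in>{1..n}. (a \<in> S) = fst (I a) then e * h (out_set n I S) (out_shift k n I m) else 0)"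
    by blast
  obtain e' where e': "e' \<noteq> 0"
    "\<And>h. act_word q k (block (Suc n) (I (Suc n))) h (out_set n I S) (out_shift k n I m) =
    (if (Suc n \<in> out_set n I S) = fst (I (Suc n)) then
      e' * h (set_bit (Suc n) (fst (snd (I (Suc n)))) (out_set n I S))
        ((out_shift k n I m)(Suc n := out_shift k n I m (Suc n) + block_shift k (I (Suc n)))) else 0)"
    using act_word_block[OF assms] by blast
  \<comment> \<open>The first n blocks change the set but not the bit \<open>Suc n\<close>, so the
    row condition of the new block can be tested on \<open>S\<close> itself.\<close>
  have "Suc n \<in> out_set n I S \<longleftrightarrow> Suc n \<in> S"
    by (simp add: out_set_def)
  moreover have "set_bit (Suc n) (fst (snd (I (Suc n)))) (out_set n I S) = out_set (Suc n) I S"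
    by (auto simp: out_set_def le_Suc_eq)
  moreover have "(out_shift k n I m)(Suc n := out_shift k n I m (Suc n) + block_shift k (I (Suc n))) =
      out_shift k (Suc n) I m"
    by (auto simp: out_shift_def le_Suc_eq)
  moreover have "(\<forall>a\<in>{1..Suc n}. (a \<in> S) = fst (I a)) \<longleftrightarrow>
      (\<forall>a\<in>{1..n}. (a \<in> S) = fst (I a)) \<and> (Suc n \<in> S) = fst (I (Suc n))"
    by (subst atLeastAtMostSuc_conv) auto
  ultimately show ?case
    using e e' by (intro exI[of _ "e * e'"]) (simp add: act_word_append mult.assoc)
qed

section \<open>Linear independence of the normal words\<close>

definition indices :: "nat \<Rightarrow> bindex set" where
  "indices k = UNIV \<times> UNIV \<times> {..<2 * k}"

lemma card_indices: "card (indices k) = 8 * k"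
  by (simp add: indices_def card_cartesian_product)

text \<open>Matrix coefficients tell normal words apart: \<open>S\<close> is the row belonging to
  \<open>J\<close>, and \<open>h\<close> is the indicator of the column of \<open>J\<close> together
  with its exponents of x modulo 2k.\<close>

lemma normal_words_separated:
  fixes q :: "'a::field" and n :: nat
  assumes "q \<noteq> 0" "J \<in> {1..n} \<rightarrow>\<^sub>E indices k"
  obtains h :: "'a fock" and S m where "periodic k h"
    "\<And>I. I \<in> {1..n} \<rightarrow>\<^sub>E indices k \<Longrightarrow> act_word q k (normal_word n I) h S m \<noteq> 0 \<longleftrightarrow> I = J"
proof -
  define S where "S = {a\<in>{1..n}. fst (J a)}"
  define h :: "'a fock" where "h = (\<lambda>S' m. if S' = out_set n J S \<and>
    (\<forall>a. m a mod (2 * int k) = out_shift k n J (\<lambda>_. 0) a mod (2 * int k)) then 1 else 0)"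
  have "(m(a := m a + 2 * int k)) b mod (2 * int k) = m b mod (2 * int k)" for m :: "nat \<Rightarrow> int" and a b
    by simp
  then have "periodic k h"
    unfolding periodic_def h_def by presburger
  moreover have "act_word q k (normal_word n I) h S (\<lambda>_. 0) \<noteq> 0 \<longleftrightarrow> I = J"
    if I: "I \<in> {1..n} \<rightarrow>\<^sub>E indices k" for I
  proof -
    obtain e where e: "e \<noteq> 0" "act_word q k (normal_word n I) h S (\<lambda>_. 0) =
      (if \<forall>a\<in>{1..n}. (a \<in> S) = fst (I a) then
        e * h (out_set n I S) (out_shift k n I (\<lambda>_. 0)) else 0)"
      using act_word_normal_word[OF assms(1)] by blast
    show ?thesis
    proof
      assume "I = J"
      then show "act_word q k (normal_word n I) h S (\<lambda>_. 0) \<noteq> 0"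
        using e by (auto simp: h_def S_def)
    next
      assume "act_word q k (normal_word n I) h S (\<lambda>_. 0) \<noteq> 0"
      then have 1: "\<forall>a\<in>{1..n}. (a \<in> S) = fst (I a)"
        and nz: "h (out_set n I S) (out_shift k n I (\<lambda>_. 0)) \<noteq> 0"
        unfolding e(2) by (auto split: if_splits)
      from nz have "out_set n I S = out_set n J S" and
        3: "\<And>a. out_shift k n I (\<lambda>_. 0) a mod (2 * int k) = out_shift k n J (\<lambda>_. 0) a mod (2 * int k)"
        by (simp_all add: h_def split: if_splits)
      then have 2: "\<forall>a\<in>{1..n}. fst (snd (I a)) = fst (snd (J a))"
        by (auto simp: out_set_def)
      have "I a = J a" if a: "a \<in> {1..n}" for a
      proof -
        obtain s s' i where Ia: "I a = (s, s', i)" by (cases "I a")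
        obtain t t' j where Ja: "J a = (t, t', j)" by (cases "J a")
        have st: "s = t" "s' = t'"
          using bspec[OF 1 a] bspec[OF 2 a] a by (simp_all add: S_def Ia Ja)
        have "i < 2 * k" "j < 2 * k"
          using PiE_mem[OF I a] PiE_mem[OF assms(2) a] by (auto simp: indices_def Ia Ja)
        \<comment> \<open>The bits already agree, so the offset in \<open>block_shift\<close>
          cancels and only the powers of \<omega>, both below 2k, are compared.\<close>
        moreover have "int i mod (2 * int k) = int j mod (2 * int k)"
          using 3[of a] a by (simp add: out_shift_def Ia Ja st mod_eq_dvd_iff split: if_splits)
        ultimately show ?thesis
          by (simp add: Ia Ja st)
      qed
      then show "I = J"
        using I assms(2) by (intro PiE_ext[of I _ _ J]) auto
    qed
  qed
  ultimately show ?thesis by (rule that)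
qed

lemma act_alg_sum:
  assumes "finite A"
  shows "fin_supp (\<lambda>w. \<Sum>i\<in>A. c i * fword (x i) w) \<and>
    act_alg q k (\<lambda>w. \<Sum>i\<in>A. c i * fword (x i) w) h S m = (\<Sum>i\<in>A. c i * act_word q k (x i) h S m)"
  using assms
proof (induction A rule: finite_induct)
  case empty
  then show ?case by (simp add: fin_supp_def act_alg_def)
next
  case (insert i A)
  have "(\<lambda>w. \<Sum>i\<in>insert i A. c i * fword (x i) w) =
      fadd (fsmul (c i) (fword (x i))) (\<lambda>w. \<Sum>i\<in>A. c i * fword (x i) w)"
    using insert by (simp add: fadd_def fsmul_def)
  then show ?case using insert by simp
qed

lemma finite_normal_indices: "finite ({1..n::nat} \<rightarrow>\<^sub>E indices k)"
  by (intro finite_PiE) (simp_all add: indices_def)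

text \<open>The ideal acts as zero, while evaluation at the vector separating \<open>J\<close>
  leaves a nonzero multiple of \<open>c J\<close>.\<close>

lemma normal_words_independent:
  fixes q :: "'a::field" and n :: nat
  assumes "q \<noteq> 0"
    and ideal: "(\<lambda>w. \<Sum>I\<in>{1..n} \<rightarrow>\<^sub>E indices k. c I * fword (normal_word n I) w) \<in> Cl_ideal q n k"
    and J: "J \<in> {1..n} \<rightarrow>\<^sub>E indices k"
  shows "c J = 0"
proof -
  obtain h :: "'a fock" and S m where h: "periodic k h"
    and sep: "\<And>I. I \<in> {1..n} \<rightarrow>\<^sub>E indices k \<Longrightarrow> act_word q k (normal_word n I) h S m \<noteq> 0 \<longleftrightarrow> I = J"
    by (rule normal_words_separated[OF assms(1) J]) blast
  have "0 = (\<Sum>I\<in>{1..n} \<rightarrow>\<^sub>E indices k. c I * act_word q k (normal_word n I) h S m)"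
    unfolding conjunct2[OF act_alg_sum[OF finite_normal_indices], symmetric]
    using conjunct2[OF act_alg_Cl_ideal[OF ideal assms(1) h]] by (rule sym)
  also have "\<dots> = (\<Sum>I\<in>{J}. c I * act_word q k (normal_word n I) h S m)"
    by (rule sum.mono_neutral_right) (use J sep finite_normal_indices in auto)
  finally show ?thesis
    using sep[OF J] by simp
qed

section \<open>Normal words span\<close>

lemma Cl_rels_mem:
  assumes "a \<in> {1..n}" "b \<in> {1..n}"
  shows "fsub (fword [Om a, Om b]) (fword [Om b, Om a]) \<in> Cl_rels q n k"
    "fsub (fword [Om a, OmI a]) (fword []) \<in> Cl_rels q n k"
    "fsub (fword [OmI a, Om a]) (fword []) \<in> Cl_rels q n k"
    "fsub (fword [Om a, Psi b]) (fsmul (q ^ (if a = b then 1 else 0)) (fword [Psi b, Om a])) \<in> Cl_rels q n k"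
    "fsub (fword [Om a, PsiS b]) (fsmul (inverse q ^ (if a = b then 1 else 0)) (fword [PsiS b, Om a]))
      \<in> Cl_rels q n k"
    "fadd (fword [Psi a, Psi b]) (fword [Psi b, Psi a]) \<in> Cl_rels q n k"
    "fadd (fword [PsiS a, PsiS b]) (fword [PsiS b, PsiS a]) \<in> Cl_rels q n k"
    "fsub (fadd (fword [Psi a, PsiS a]) (fsmul (q ^ k) (fword [PsiS a, Psi a])))
      (fword (replicate k (OmI a))) \<in> Cl_rels q n k"
    "fsub (fadd (fword [Psi a, PsiS a]) (fsmul (inverse q ^ k) (fword [PsiS a, Psi a])))
      (fword (replicate k (Om a))) \<in> Cl_rels q n k"
    "a \<noteq> b \<Longrightarrow> fadd (fword [Psi a, PsiS b]) (fword [PsiS b, Psi a]) \<in> Cl_rels q n k"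
  unfolding Cl_rels_words
  by (rule UN_I[OF assms(1)], rule UN_I[OF assms(2)], simp)+

text \<open>In the end \<open>M\<close> will be the ideal plus the span of the normal words, so that
  spanning means \<open>FA n \<subseteq> M\<close>.\<close>

locale Cl_subspace =
  fixes q :: "'a::field" and n k :: nat and M :: "'a falg set"
  assumes two_nonzero: "(2::'a) \<noteq> 0" and q_nonzero: "q \<noteq> 0" and k_pos: "0 < k"
    and ideal_subset: "Cl_ideal q n k \<subseteq> M"
    and add_closed: "f \<in> M \<Longrightarrow> g \<in> M \<Longrightarrow> fadd f g \<in> M"
    and smul_closed: "f \<in> M \<Longrightarrow> fsmul c f \<in> M"
begin

text \<open>Words with a letter outside \<open>Gens n\<close> count as spanned, so that contexts may
  range over all words.\<close>

definition spanned :: "gen list \<Rightarrow> bool" where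
  "spanned w \<longleftrightarrow> (set w \<subseteq> Gens n \<longrightarrow> fword w \<in> M)"

text \<open>Since \<open>M\<close> is a subspace, scalars can be forgotten: \<open>reduces x Y\<close> abstracts the statement
  that \<open>x\<close> is congruent to a linear combination of words in \<open>Y\<close>.\<close>

definition reduces :: "gen list \<Rightarrow> gen list set \<Rightarrow> bool" where
  "reduces x Y \<longleftrightarrow> (\<forall>u v. (\<forall>y\<in>Y. spanned (u @ y @ v)) \<longrightarrow> spanned (u @ x @ v))"

lemma reduces_refl: "x \<in> Y \<Longrightarrow> reduces x Y"
  by (simp add: reduces_def)

text \<open>The chaining rule: rewrite a factor of a word, then reduce every word that arises. The
  outer context is absorbed because \<open>reduces\<close> quantifies over all contexts.\<close>

lemma reduces_in_context:
  assumes "reduces x Y" "\<And>y. y \<in> Y \<Longrightarrow> reduces (u @ y @ v) Z"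
  shows "reduces (u @ x @ v) Z"
  unfolding reduces_def
proof (intro allI impI)
  fix u' v' assume "\<forall>z\<in>Z. spanned (u' @ z @ v')"
  then have "\<forall>y\<in>Y. spanned ((u' @ u) @ y @ (v @ v'))"
    using assms(2) by (simp add: reduces_def)
  then show "spanned (u' @ (u @ x @ v) @ v')"
    using assms(1)[unfolded reduces_def, rule_format, of "u' @ u" "v @ v'"] by simp
qed

lemmas reduces_trans = reduces_in_context[where u = "[]" and v = "[]", simplified]
lemmas reduces_prefix = reduces_in_context[where u = "[]", simplified]
lemmas reduces_suffix = reduces_in_context[where v = "[]", simplified]

text \<open>Multiplied by \<open>u\<close> and \<open>v\<close> the relation stays in the ideal, and
  it can be solved for the term in \<open>x\<close>, whose coefficient is invertible. Zero
  coefficients let shorter relations fit the three-term form.\<close>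

lemma reduces_by_relation:
  assumes "r \<in> Cl_rels q n k"
    and r: "r = fadd (fsmul \<alpha> (fword x)) (fadd (fsmul \<beta> (fword y)) (fsmul \<gamma> (fword z)))"
    and "\<alpha> \<noteq> 0" and y: "\<beta> = 0 \<or> y \<in> Y \<and> set y \<subseteq> Gens n" and z: "\<gamma> = 0 \<or> z \<in> Y \<and> set z \<subseteq> Gens n"
  shows "reduces x Y"
  unfolding reduces_def
proof (intro allI impI)
  fix u v assume Y: "\<forall>y\<in>Y. spanned (u @ y @ v)"
  have zero: "fsmul 0 f \<in> M" for f
    using ideal_subset ideal_gen.zero[of n "Cl_rels q n k"]
    by (auto simp: Cl_ideal_def fsmul_def fzero_def)
  show "spanned (u @ x @ v)"
    unfolding spanned_def
  proof
    assume G: "set (u @ x @ v) \<subseteq> Gens n"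
    let ?R = "fmul (fword u) (fmul r (fword v))"
    let ?y = "fsmul \<beta> (fword (u @ y @ v))" and ?z = "fsmul \<gamma> (fword (u @ z @ v))"
    have "?R \<in> Cl_ideal q n k"
      using assms(1) G unfolding Cl_ideal_def
      by (intro ideal_gen.lmul ideal_gen.rmul ideal_gen.base fword_in_FA) auto
    then have "?R \<in> M" using ideal_subset by blast
    moreover have "?y \<in> M"
      using y zero Y G smul_closed by (cases "\<beta> = 0") (auto simp: spanned_def)
    moreover have "?z \<in> M"
      using z zero Y G smul_closed by (cases "\<gamma> = 0") (auto simp: spanned_def)
    ultimately have "fadd ?R (fsmul (-1) (fadd ?y ?z)) \<in> M"
      using add_closed smul_closed by blast
    then have "fsmul (1 / \<alpha>) (fadd ?R (fsmul (-1) (fadd ?y ?z))) \<in> M"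
      by (rule smul_closed)
    moreover have "?R = fadd (fsmul \<alpha> (fword (u @ x @ v))) (fadd ?y ?z)"
      by (simp add: r fmul_fadd_left fmul_fadd_right fmul_fsmul_left fmul_fsmul_right fmul_fword)
    ultimately show "fword (u @ x @ v) \<in> M"
      using \<open>\<alpha> \<noteq> 0\<close> by (simp add: fadd_def fsmul_def)
  qed
qed

lemma reduces_two_terms:
  assumes "r \<in> Cl_rels q n k" "r = fadd (fsmul \<alpha> (fword x)) (fsmul \<beta> (fword y))"
    "\<alpha> \<noteq> 0" "\<beta> \<noteq> 0" "set x \<subseteq> Gens n" "set y \<subseteq> Gens n"
  shows "reduces x {y}" "reduces y {x}"
  using assms
  by (auto intro!: reduces_by_relation[of r \<alpha> x \<beta> y 0 y] reduces_by_relation[of r \<beta> y \<alpha> x 0 x]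
      simp: fadd_def fsmul_def)

section \<open>Exchanging letters\<close>

lemma letters_in_Gens: "gen_idx g \<in> {1..n} \<Longrightarrow> g \<in> Gens n"
  by (simp add: Gens_def)

lemma reduces_Om_cancel:
  assumes "a \<in> {1..n}"
  shows "reduces [Om a, OmI a] {[]}" "reduces [] {[Om a, OmI a]}"
    "reduces [OmI a, Om a] {[]}" "reduces [] {[OmI a, Om a]}"
proof -
  show "reduces [Om a, OmI a] {[]}" "reduces [] {[Om a, OmI a]}"
    using assms letters_in_Gens
    by (rule_tac reduces_two_terms[OF Cl_rels_mem(2)[OF assms assms], where \<alpha> = 1 and \<beta> = "-1"];
        simp add: fsub_eq fsmul_def)+
  show "reduces [OmI a, Om a] {[]}" "reduces [] {[OmI a, Om a]}"
    using assms letters_in_Gens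
    by (rule_tac reduces_two_terms[OF Cl_rels_mem(3)[OF assms assms], where \<alpha> = 1 and \<beta> = "-1"];
        simp add: fsub_eq fsmul_def)+
qed

lemma reduces_swap_Om:
  assumes "a \<in> {1..n}" "gen_idx g \<in> {1..n}" "\<And>b. g \<noteq> OmI b"
  shows "reduces [Om a, g] {[g, Om a]} \<and> reduces [g, Om a] {[Om a, g]}"
proof (cases g)
  case (Psi b)
  then have b: "b \<in> {1..n}" using assms by simp
  show ?thesis
    using assms(1) b letters_in_Gens q_nonzero unfolding Psi
    by (intro conjI; rule_tac reduces_two_terms[OF Cl_rels_mem(4)[OF assms(1) b], where \<alpha> = 1
          and \<beta> = "- (q ^ (if a = b then 1 else 0))"]; simp add: fsub_eq fsmul_def)
next
  case (PsiS b)
  then have b: "b \<in> {1..n}" using assms by simp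
  show ?thesis
    using assms(1) b letters_in_Gens q_nonzero unfolding PsiS
    by (intro conjI; rule_tac reduces_two_terms[OF Cl_rels_mem(5)[OF assms(1) b], where \<alpha> = 1
          and \<beta> = "- (inverse q ^ (if a = b then 1 else 0))"]; simp add: fsub_eq fsmul_def)
next
  case (Om b)
  then have b: "b \<in> {1..n}" using assms by simp
  show ?thesis
    using assms(1) b letters_in_Gens unfolding Om
    by (intro conjI; rule_tac reduces_two_terms[OF Cl_rels_mem(1)[OF assms(1) b], where \<alpha> = 1
          and \<beta> = "-1"]; simp add: fsub_eq fsmul_def)
qed (use assms in auto)

text \<open>The relations contain no exchange rule for \<open>OmI\<close>; it comes from the one for
  \<open>Om\<close> by conjugation. An inverse on the right is excluded, as normal words contain
  none.\<close>

lemma reduces_swap_distinct: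
  assumes "gen_idx g \<in> {1..n}" "gen_idx h \<in> {1..n}" "gen_idx g \<noteq> gen_idx h" "\<And>b. h \<noteq> OmI b"
  shows "reduces [g, h] {[h, g]}"
proof (cases "\<exists>a. g = Om a \<or> h = Om a \<or> g = OmI a")
  case True
  then consider a where "g = Om a" | a where "h = Om a" "\<And>b. g \<noteq> OmI b" | a where "g = OmI a"
    by blast
  then show ?thesis
  proof cases
    case (3 a)
    then have a: "a \<in> {1..n}" using assms(1) by simp
    \<comment> \<open>Up to a scalar, \<omega>^(-1) h = \<omega>^(-1) h \<omega> \<omega>^(-1) =
      \<omega>^(-1) \<omega> h \<omega>^(-1) = h \<omega>^(-1).\<close>
    have "reduces ([OmI a] @ [h, Om a] @ [OmI a]) {[h, OmI a]}"
    proof (rule reduces_in_context)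
      show "reduces [h, Om a] {[Om a, h]}"
        using reduces_swap_Om a assms by blast
      have "reduces ([OmI a, Om a] @ [h, OmI a]) {[h, OmI a]}"
        using reduces_Om_cancel(3)[OF a] by (rule reduces_prefix) (auto intro: reduces_refl)
      then show "reduces ([OmI a] @ y @ [OmI a]) {[h, OmI a]}" if "y \<in> {[Om a, h]}" for y
        using that by simp
    qed
    then have "reduces ([OmI a, h] @ []) {[h, OmI a]}"
      using reduces_Om_cancel(2)[OF a] by (intro reduces_suffix[where x = "[]"]) auto
    then show ?thesis by (simp add: 3)
  qed (use reduces_swap_Om assms in auto)
next
  case False
  then have "(\<exists>a. g = Psi a \<or> g = PsiS a) \<and> (\<exists>b. h = Psi b \<or> h = PsiS b)"
    using assms(4) by (cases g; cases h) auto
  then obtain a b where ab: "g = Psi a \<or> g = PsiS a" "h = Psi b \<or> h = PsiS b"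
    by blast
  then have a: "a \<in> {1..n}" and b: "b \<in> {1..n}" and "a \<noteq> b"
    using assms by auto
  note rels = Cl_rels_mem(6)[OF a b] Cl_rels_mem(7)[OF a b] Cl_rels_mem(10)[OF a b \<open>a \<noteq> b\<close>]
    Cl_rels_mem(10)[OF b a \<open>a \<noteq> b\<close>[symmetric]]
  have gens: "{Psi a, Psi b, PsiS a, PsiS b} \<subseteq> Gens n"
    using a b letters_in_Gens by simp
  have "reduces [Psi a, Psi b] {[Psi b, Psi a]}"
    by (rule reduces_two_terms(1)[OF rels(1), of 1 _ 1]) (use gens in \<open>simp_all add: fsmul_def\<close>)
  moreover have "reduces [PsiS a, PsiS b] {[PsiS b, PsiS a]}"
    by (rule reduces_two_terms(1)[OF rels(2), of 1 _ 1]) (use gens in \<open>simp_all add: fsmul_def\<close>)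
  moreover have "reduces [Psi a, PsiS b] {[PsiS b, Psi a]}"
    by (rule reduces_two_terms(1)[OF rels(3), of 1 _ 1]) (use gens in \<open>simp_all add: fsmul_def\<close>)
  \<comment> \<open>The mixed relation is taken with its indices exchanged and read from right to
    left.\<close>
  moreover have "reduces [PsiS a, Psi b] {[Psi b, PsiS a]}"
    by (rule reduces_two_terms(2)[OF rels(4), of 1 _ 1]) (use gens in \<open>simp_all add: fsmul_def\<close>)
  ultimately show ?thesis
    using ab by blast
qed

section \<open>Quadratic relations within one factor\<close>

definition conj_pair :: "nat \<Rightarrow> gen \<Rightarrow> gen \<Rightarrow> bool" where
  "conj_pair a g g' \<longleftrightarrow> g = Psi a \<and> g' = PsiS a \<or> g = PsiS a \<and> g' = Psi a"

text \<open>At equal indices anticommutation reads 2 g^2 = 0, and 2 is invertible. The word vanishes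
  in the quotient, so it reduces even to the empty set.\<close>

lemma reduces_square:
  assumes "a \<in> {1..n}" "conj_pair a g g'"
  shows "reduces [g, g] Y"
  using assms two_nonzero Cl_rels_mem(6,7)[OF assms(1) assms(1), of q k]
  by (intro reduces_by_relation[where r = "fadd (fword [g, g]) (fword [g, g])" and \<alpha> = 2 and \<beta> = 0 and \<gamma> = 0])
     (auto simp: conj_pair_def fadd_def fsmul_def)

text \<open>Both quadratic relations equate \<open>w\<close> with \<psi> \<psi>* + c \<psi>* \<psi>,
  where c is q^(-k) or q^k. All coefficients are nonzero, so each term is a combination of the other
  two.\<close>

lemma reduces_conj_pair:
  assumes a: "a \<in> {1..n}" and "conj_pair a g g'" and w: "w \<in> {replicate k (Om a), replicate k (OmI a)}"
  shows "reduces w {[g, g'], [g', g]} \<and> reduces [g, g'] {[g', g], w}"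
proof -
  define c where "c = (if w = replicate k (Om a) then inverse q ^ k else q ^ k)"
  have c: "c \<noteq> 0"
    using q_nonzero by (simp add: c_def)
  have rel: "fsub (fadd (fword [Psi a, PsiS a]) (fsmul c (fword [PsiS a, Psi a]))) (fword w) \<in> Cl_rels q n k"
  proof (cases "w = replicate k (Om a)")
    case True
    then show ?thesis using Cl_rels_mem(9)[OF a a, of q k] by (simp add: c_def)
  next
    case False
    then show ?thesis using Cl_rels_mem(8)[OF a a, of q k] w by (simp add: c_def)
  qed
  have gens: "Psi a \<in> Gens n" "PsiS a \<in> Gens n" "set w \<subseteq> Gens n"
    using a w by (auto simp: Gens_def)
  have "reduces w {[Psi a, PsiS a], [PsiS a, Psi a]}"
    by (rule reduces_by_relation[OF rel, where \<alpha> = "-1" and \<beta> = 1 and \<gamma> = c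
          and y = "[Psi a, PsiS a]" and z = "[PsiS a, Psi a]"])
       (use gens in \<open>simp_all add: fsub_def fadd_def fsmul_def algebra_simps\<close>)
  moreover have "reduces [Psi a, PsiS a] {[PsiS a, Psi a], w}"
    by (rule reduces_by_relation[OF rel, where \<alpha> = 1 and \<beta> = "-1" and \<gamma> = c
          and y = w and z = "[PsiS a, Psi a]"])
       (use gens in \<open>simp_all add: fsub_def fadd_def fsmul_def algebra_simps\<close>)
  moreover have "reduces [PsiS a, Psi a] {[Psi a, PsiS a], w}"
    by (rule reduces_by_relation[OF rel, where \<alpha> = c and \<beta> = "-1" and \<gamma> = 1
          and y = w and z = "[Psi a, PsiS a]"])
       (use gens c in \<open>simp_all add: fsub_def fadd_def fsmul_def algebra_simps\<close>)
  ultimately show ?thesis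
    using assms(2) by (auto simp: conj_pair_def insert_commute)
qed

lemma reduces_replicate_cancel:
  assumes "reduces [g, h] {[]}"
  shows "reduces (replicate j g @ replicate j h) {[]}"
proof (induction j)
  case (Suc j)
  have "reduces (replicate j g @ [g, h] @ replicate j h) {[]}"
    using assms by (rule reduces_in_context) (use Suc in simp)
  then show ?case by (simp add: replicate_app_Cons_same)
qed (simp add: reduces_refl)

lemma reduces_replicate_insert:
  assumes "reduces [] {[g, h]}"
  shows "reduces [] {replicate j g @ replicate j h}"
proof (induction j)
  case (Suc j)
  have "reduces (replicate j g @ [] @ replicate j h) {replicate (Suc j) g @ replicate (Suc j) h}"
    using assms
    by (rule reduces_in_context) (simp add: reduces_refl replicate_app_Cons_same)
  then show ?case using Suc by (intro reduces_trans[OF Suc]) simp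
qed (simp add: reduces_refl)

lemma reduces_move_right:
  assumes "\<And>h. h \<in> set y \<Longrightarrow> reduces [g, h] {[h, g]}"
  shows "reduces (g # y) {y @ [g]}"
  using assms
proof (induction y)
  case (Cons h y)
  have "reduces ([h] @ g # y) {(h # y) @ [g]}"
    using Cons by (intro reduces_suffix[where x = "g # y"]) (auto intro: reduces_refl)
  then have "reduces ([g, h] @ y) {(h # y) @ [g]}"
    using Cons by (intro reduces_prefix[where x = "[g, h]"]) auto
  then show ?case by simp
qed (simp add: reduces_refl)

lemma reduces_move_left:
  assumes "\<And>h. h \<in> set y \<Longrightarrow> reduces [h, g] {[g, h]}"
  shows "reduces (y @ [g]) {g # y}"
  using assms
proof (induction y rule: rev_induct)
  case (snoc h y)
  have "reduces ((y @ [g]) @ [h]) {g # y @ [h]}"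
    using snoc by (intro reduces_prefix[where x = "y @ [g]"]) (auto intro: reduces_refl)
  then have "reduces (y @ [h, g]) {g # y @ [h]}"
    using snoc by (intro reduces_suffix[where x = "[h, g]"]) auto
  then show ?case by simp
qed (simp add: reduces_refl)

lemma reduces_move_replicate_left:
  assumes "\<And>h. h \<in> set y \<Longrightarrow> reduces [h, g] {[g, h]}"
  shows "reduces (y @ replicate j g) {replicate j g @ y}"
proof (induction j)
  case (Suc j)
  have "reduces ([g] @ (y @ replicate j g)) {replicate (Suc j) g @ y}"
    using Suc by (rule reduces_suffix) (simp add: reduces_refl)
  then have "reduces ((y @ [g]) @ replicate j g) {replicate (Suc j) g @ y}"
    using reduces_move_left[OF assms] by (intro reduces_prefix[where x = "y @ [g]"]) auto
  then show ?case by simp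
qed (simp add: reduces_refl)

text \<open>Multiplying the quadratic relation by \<open>g\<close> on the right kills the product g'
  g g, since \<open>g\<close> squares to zero.\<close>

lemma reduces_sandwich:
  assumes a: "a \<in> {1..n}" and p: "conj_pair a g g'" and w: "w \<in> {replicate k (Om a), replicate k (OmI a)}"
  shows "reduces (w @ [g]) {[g, g', g]}" "reduces [g, g', g] {w @ [g]}"
proof -
  have zero: "reduces ([g'] @ [g, g]) Y" for Y
    by (rule reduces_suffix[OF reduces_square[OF a p, of "{}"]]) simp
  show "reduces (w @ [g]) {[g, g', g]}"
    using conjunct1[OF reduces_conj_pair[OF a p w]]
    by (rule reduces_prefix) (use zero in \<open>auto intro: reduces_refl\<close>)
  have "reduces ([g, g'] @ [g]) {w @ [g]}"
    using conjunct2[OF reduces_conj_pair[OF a p w]]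
    by (rule reduces_prefix) (use zero in \<open>auto intro: reduces_refl\<close>)
  then show "reduces [g, g', g] {w @ [g]}" by simp
qed

text \<open>The sandwich identity for both choices of \<open>w\<close> makes \<omega>^k g and
  \<omega>^(-k) g proportional; multiplication by \<omega>^k gives the period.\<close>

lemma reduces_period:
  assumes a: "a \<in> {1..n}" and p: "conj_pair a g g'"
  shows "reduces (replicate (2 * k) (Om a) @ [g]) {[g]}"
    "reduces [g] {replicate (2 * k) (Om a) @ [g]}"
proof -
  let ?o = "replicate k (Om a)" and ?i = "replicate k (OmI a)"
  have double: "replicate (2 * k) (Om a) = ?o @ ?o"
    by (simp add: mult_2 replicate_add)
  have oi: "reduces (?o @ [g]) {?i @ [g]}" and io: "reduces (?i @ [g]) {?o @ [g]}"
    by (auto intro: reduces_trans[OF reduces_sandwich(1)[OF a p]] reduces_sandwich(2)[OF a p])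
  have "reduces ((?o @ ?i) @ [g]) {[g]}"
    using reduces_replicate_cancel[OF reduces_Om_cancel(1)[OF a]]
    by (rule reduces_prefix) (simp add: reduces_refl)
  then have "reduces (?o @ (?o @ [g])) {[g]}"
    by (intro reduces_suffix[OF oi]) simp
  then show "reduces (replicate (2 * k) (Om a) @ [g]) {[g]}"
    by (simp add: double)
  have "reduces (?o @ (?i @ [g])) {?o @ ?o @ [g]}"
    by (rule reduces_suffix[OF io]) (simp add: reduces_refl)
  then have "reduces ([] @ [g]) {?o @ ?o @ [g]}"
    using reduces_replicate_insert[OF reduces_Om_cancel(2)[OF a], of k]
    by (intro reduces_prefix[where x = "[]"]) auto
  then show "reduces [g] {replicate (2 * k) (Om a) @ [g]}"
    by (simp add: double)
qed

section \<open>Absorbing a letter into one block\<close>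

definition blocks :: "nat \<Rightarrow> gen list set" where
  "blocks a = block a ` indices k"

lemma blocksI: "j < 2 * k \<Longrightarrow> head a s s' @ replicate j (Om a) \<in> blocks a"
  unfolding blocks_def indices_def by (rule image_eqI[of _ _ "(s, s', j)"]) auto

lemma head_shape:
  obtains g g' where "conj_pair a g g'" "head a s s' = [g] \<or> head a s s' = [g, g']"
  by (cases s; cases s') (auto simp: conj_pair_def)

lemma conj_pair_head:
  assumes "conj_pair a g g'"
  shows "\<exists>s s'. [g] = head a s s'" "\<exists>s s'. [g, g'] = head a s s'"
  using assms unfolding conj_pair_def
  by (metis head.simps)+

lemma head_letters: "g \<in> set (head a s s') \<Longrightarrow> g = Psi a \<or> g = PsiS a"
  by (cases s; cases s') auto

lemma reduces_Om_block:
  assumes a: "a \<in> {1..n}" and "x \<in> blocks a"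
  shows "reduces (Om a # x) (blocks a)"
proof -
  obtain s s' j where x: "x = head a s s' @ replicate j (Om a)" and j: "j < 2 * k"
    using assms(2) by (auto simp: blocks_def indices_def)
  have swap: "reduces [Om a, h] {[h, Om a]}" "reduces [h, Om a] {[Om a, h]}"
    if "h \<in> set (head a s s')" for h
    using head_letters[OF that] reduces_swap_Om[OF a, of h] a by auto
  have "reduces (head a s s' @ replicate (Suc j) (Om a)) (blocks a)"
  proof (cases "Suc j < 2 * k")
    case True
    then show ?thesis by (intro reduces_refl blocksI)
  next
    case False
    \<comment> \<open>When the exponent reaches 2k, the powers go back to the front, where they meet
      the first letter of the head and disappear, leaving exponent 0.\<close>
    then have "Suc j = 2 * k" using j by simp
    obtain g g' v where g: "conj_pair a g g'" and v: "head a s s' = [g] @ v"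
      using head_shape[of a s s'] by (metis append_Cons append_Nil append_Nil2)
    have "reduces ((replicate (2 * k) (Om a) @ [g]) @ v) (blocks a)"
    proof (rule reduces_prefix[OF reduces_period(1)[OF a g]])
      show "reduces (y @ v) (blocks a)" if "y \<in> {[g]}" for y
        using blocksI[of 0 a s s'] k_pos that v by (auto intro: reduces_refl)
    qed
    then show ?thesis
      unfolding \<open>Suc j = 2 * k\<close>
      by (intro reduces_trans[OF reduces_move_replicate_left[OF swap(2)]]) (simp_all add: v)
  qed
  then have "reduces ((Om a # head a s s') @ replicate j (Om a)) (blocks a)"
    using reduces_move_right[OF swap(1)] by (intro reduces_prefix[where x = "Om a # head a s s'"]) auto
  then show ?thesis by (simp add: x)
qed

lemma reduces_Om_power_block:
  assumes a: "a \<in> {1..n}" and "x \<in> blocks a"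
  shows "reduces (replicate j (Om a) @ x) (blocks a)"
proof (induction j)
  case (Suc j)
  then have "reduces ([Om a] @ (replicate j (Om a) @ x)) (blocks a)"
    by (rule reduces_suffix) (use reduces_Om_block[OF a] in auto)
  then show ?case by simp
qed (use assms in \<open>simp add: reduces_refl\<close>)

text \<open>Either a square g g appears, or g extends the head g' to g g', or the head g' g becomes
  g g' g, which is traded for \<omega>^k g.\<close>

lemma reduces_conj_block:
  assumes a: "a \<in> {1..n}" and p: "conj_pair a g g'" and "x \<in> blocks a"
  shows "reduces (g # x) (blocks a)"
proof -
  obtain s s' j where x: "x = head a s s' @ replicate j (Om a)" and j: "j < 2 * k"
    using assms(3) by (auto simp: blocks_def indices_def)
  have "(\<exists>v. head a s s' = g # v) \<or> head a s s' = [g'] \<or> head a s s' = [g', g]"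
    using p by (cases s; cases s') (auto simp: conj_pair_def)
  then consider v where "head a s s' = g # v" | "head a s s' = [g']" | "head a s s' = [g', g]"
    by blast
  then show ?thesis
  proof cases
    case (1 v)
    have "reduces ([g, g] @ v @ replicate j (Om a)) (blocks a)"
      by (rule reduces_prefix[OF reduces_square[OF a p, of "{}"]]) simp
    then show ?thesis by (simp add: x 1)
  next
    case 2
    have "[g, g'] @ replicate j (Om a) \<in> blocks a"
      using conj_pair_head(2)[OF p] blocksI[OF j, of a] by metis
    then show ?thesis
      by (simp add: x 2 reduces_refl)
  next
    case 3
    have "[g] @ replicate j (Om a) \<in> blocks a"
      using conj_pair_head(1)[OF p] blocksI[OF j, of a] by metis
    then have "reduces ([g, g', g] @ replicate j (Om a)) (blocks a)"
      using reduces_sandwich(2)[OF a p] reduces_Om_power_block[OF a]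
      by (intro reduces_prefix[where x = "[g, g', g]"]) auto
    then show ?thesis by (simp add: x 3)
  qed
qed

text \<open>Blocks begin with some \<open>g\<close> from a conjugate pair, which is first replaced
  by a multiple of \<omega>^(2k) g. One factor \<omega> cancels the inverse and
  \<open>2 * k - 1\<close> remain to be absorbed.\<close>

lemma reduces_OmI_block:
  assumes a: "a \<in> {1..n}" and "x \<in> blocks a"
  shows "reduces (OmI a # x) (blocks a)"
proof -
  let ?o = "\<lambda>j. replicate j (Om a)"
  obtain s s' j where "x = head a s s' @ ?o j"
    using assms(2) by (auto simp: blocks_def)
  then obtain g g' v where g: "conj_pair a g g'" and v: "x = [g] @ v"
    using head_shape[of a s s'] by (metis append_Cons append_Nil)
  have "?o (2 * k) = Om a # ?o (2 * k - 1)"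
    using k_pos by (cases "2 * k") auto
  moreover have "reduces ([OmI a, Om a] @ (?o (2 * k - 1) @ x)) (blocks a)"
    by (rule reduces_prefix[OF reduces_Om_cancel(3)[OF a]])
       (use reduces_Om_power_block[OF assms] in simp)
  ultimately have "reduces ([OmI a] @ [g] @ v) (blocks a)"
    by (intro reduces_in_context[OF reduces_period(2)[OF a g]]) (simp add: v)
  then show ?thesis by (simp add: v)
qed

lemma reduces_letter_block:
  assumes "gen_idx g \<in> {1..n}" "x \<in> blocks (gen_idx g)"
  shows "reduces (g # x) (blocks (gen_idx g))"
  using assms reduces_conj_block[of _ g] reduces_Om_block reduces_OmI_block
  by (cases g) (auto simp: conj_pair_def)

text \<open>Write 1 as \<omega>^(-k) \<omega>^k and expand \<omega>^(-k) in \<psi> \<psi>* and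
  \<psi>* \<psi>; the remaining exponent k is below 2k.\<close>

lemma reduces_Nil_blocks:
  assumes a: "a \<in> {1..n}"
  shows "reduces [] (blocks a)"
proof (rule reduces_trans[OF reduces_replicate_insert[OF reduces_Om_cancel(4)[OF a], of k]])
  have p: "conj_pair a (Psi a) (PsiS a)" by (simp add: conj_pair_def)
  have "reduces (replicate k (OmI a) @ replicate k (Om a)) (blocks a)"
    using conjunct1[OF reduces_conj_pair[OF a p]] k_pos blocksI[of k a False False] blocksI[of k a True True]
    by (intro reduces_prefix[where x = "replicate k (OmI a)" and Y = "{[Psi a, PsiS a], [PsiS a, Psi a]}"])
       (auto intro: reduces_refl)
  then show "reduces y (blocks a)" if "y \<in> {replicate k (OmI a) @ replicate k (Om a)}" for y
    using that by simp
qed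

section \<open>Absorbing a letter into a normal word\<close>

definition normal_words :: "nat \<Rightarrow> gen list set" where
  "normal_words m = {normal_word m I | I. \<forall>a\<in>{1..m}. I a \<in> indices k}"

lemma normal_words_0: "normal_words 0 = {[]}"
  by (simp add: normal_words_def)

lemma normal_word_cong: "(\<And>a. a \<in> {1..m} \<Longrightarrow> I a = J a) \<Longrightarrow> normal_word m I = normal_word m J"
  by (induction m) auto

lemma normal_words_Suc: "normal_words (Suc m) = {x @ y | x y. x \<in> normal_words m \<and> y \<in> blocks (Suc m)}"
proof (intro equalityI subsetI)
  fix w assume "w \<in> normal_words (Suc m)"
  then show "w \<in> {x @ y | x y. x \<in> normal_words m \<and> y \<in> blocks (Suc m)}"
    by (fastforce simp: normal_words_def blocks_def)
next
  fix w assume "w \<in> {x @ y | x y. x \<in> normal_words m \<and> y \<in> blocks (Suc m)}"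
  then obtain I i where I: "\<forall>a\<in>{1..m}. I a \<in> indices k" "i \<in> indices k"
    and w: "w = normal_word m I @ block (Suc m) i"
    by (auto simp: normal_words_def blocks_def)
  have "w = normal_word (Suc m) (I(Suc m := i))"
    using normal_word_cong[of m I "I(Suc m := i)"] by (simp add: w)
  then show "w \<in> normal_words (Suc m)"
    unfolding normal_words_def using I by (auto intro!: exI[of _ "I(Suc m := i)"] simp: le_Suc_eq)
qed

text \<open>Provides the side conditions of \<open>reduces_swap_distinct\<close> for moving a letter
  of higher index past a normal word.\<close>

lemma normal_words_letters:
  "x \<in> normal_words m \<Longrightarrow> g \<in> set x \<Longrightarrow> gen_idx g \<in> {1..m} \<and> (\<forall>b. g \<noteq> OmI b)"
proof (induction m arbitrary: x)
  case (Suc m)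
  then obtain x' s s' j where x: "x = x' @ head (Suc m) s s' @ replicate j (Om (Suc m))"
    and "x' \<in> normal_words m"
    by (auto simp: normal_words_Suc blocks_def)
  then show ?case
    using Suc.IH[of x'] Suc.prems(2) head_letters[of g] by (fastforce split: if_splits)
qed (simp add: normal_words_0)

text \<open>A letter of index at most m is absorbed by the prefix, by induction. A letter of index
  \<open>Suc m\<close> passes the whole prefix, whose indices are smaller, and is absorbed by the
  last block.\<close>

lemma reduces_letter_normal_words:
  assumes "m \<le> n" "gen_idx g \<in> {1..m}" "x \<in> normal_words m"
  shows "reduces (g # x) (normal_words m)"
  using assms
proof (induction m arbitrary: x)
  case (Suc m)
  then obtain x' y where x: "x = x' @ y" and x': "x' \<in> normal_words m" and y: "y \<in> blocks (Suc m)"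
    by (auto simp: normal_words_Suc)
  show ?case
  proof (cases "gen_idx g \<in> {1..m}")
    case True
    then have "reduces ((g # x') @ y) (normal_words (Suc m))"
      using Suc x' y
      by (intro reduces_prefix[where x = "g # x'" and Y = "normal_words m"])
         (auto simp: normal_words_Suc intro!: reduces_refl)
    then show ?thesis by (simp add: x)
  next
    case False
    then have g: "gen_idx g = Suc m" using Suc.prems by auto
    have "reduces (x' @ (g # y)) (normal_words (Suc m))"
      using reduces_letter_block[of g y] Suc.prems g y x'
      by (intro reduces_suffix[where x = "g # y" and Y = "blocks (Suc m)"])
         (auto simp: normal_words_Suc intro!: reduces_refl)
    moreover have "reduces (g # x') {x' @ [g]}"
    proof (rule reduces_move_right)
      fix h assume "h \<in> set x'"
      then show "reduces [g, h] {[h, g]}"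
        using normal_words_letters[OF x', of h] g Suc.prems by (intro reduces_swap_distinct) auto
    qed
    ultimately have "reduces ((g # x') @ y) (normal_words (Suc m))"
      by (intro reduces_prefix[where x = "g # x'"]) auto
    then show ?thesis by (simp add: x)
  qed
qed simp

lemma reduces_Nil_normal_words: "m \<le> n \<Longrightarrow> reduces [] (normal_words m)"
proof (induction m)
  case (Suc m)
  then have IH: "reduces [] (normal_words m)" by simp
  show ?case
  proof (rule reduces_trans[OF IH])
    fix x assume x: "x \<in> normal_words m"
    have "reduces (x @ []) (normal_words (Suc m))"
      using Suc.prems x
      by (intro reduces_suffix[OF reduces_Nil_blocks[of "Suc m"]])
         (auto simp: normal_words_Suc intro!: reduces_refl)
    then show "reduces x (normal_words (Suc m))" by simp
  qed
qed (simp add: normal_words_0 reduces_refl)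

lemma reduces_normal_words: "set w \<subseteq> Gens n \<Longrightarrow> reduces w (normal_words n)"
proof (induction w)
  case (Cons g w)
  then have "reduces ([g] @ w) (normal_words n)"
    by (intro reduces_suffix[where x = w and Y = "normal_words n"])
       (auto intro!: reduces_letter_normal_words simp: Gens_def)
  then show ?case by simp
qed (simp add: reduces_Nil_normal_words)

lemma FA_subset:
  assumes "\<And>w. w \<in> normal_words n \<Longrightarrow> fword w \<in> M"
  shows "FA n \<subseteq> M"
proof
  fix f :: "'a falg" assume f: "f \<in> FA n"
  have words: "fword w \<in> M" if "set w \<subseteq> Gens n" for w
    using reduces_normal_words[OF that, unfolded reduces_def, rule_format, of "[]" "[]"] assms that
    by (simp add: spanned_def)
  have zero: "(\<lambda>_. 0) \<in> M"
    using ideal_subset ideal_gen.zero[of n "Cl_rels q n k"] by (auto simp: Cl_ideal_def fzero_def)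
  \<comment> \<open>Truncations of \<open>f\<close> to finite parts of its support are assembled
    word by word; the full support returns \<open>f\<close>.\<close>
  have "(\<lambda>w. if w \<in> A then f w else 0) \<in> M" if "finite A" "A \<subseteq> {w. f w \<noteq> 0}" for A
    using that
  proof (induction A rule: finite_induct)
    case (insert u A)
    have "(\<lambda>w. if w \<in> insert u A then f w else 0) =
        fadd (fsmul (f u) (fword u)) (\<lambda>w. if w \<in> A then f w else 0)"
      using insert.hyps by (auto simp: fadd_def fsmul_def fword_def)
    moreover have "set u \<subseteq> Gens n"
      using f insert.prems by (auto simp: FA_def)
    ultimately show ?case
      using insert words by (auto intro!: add_closed smul_closed)
  qed (simp add: zero)
  from this[of "{w. f w \<noteq> 0}"] have "(\<lambda>w. if f w \<noteq> 0 then f w else 0) \<in> M"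
    using f by (simp add: FA_def)
  moreover have "(\<lambda>w. if f w \<noteq> 0 then f w else 0) = f" by auto
  ultimately show "f \<in> M" by simp
qed

end

section \<open>The dimension\<close>

theorem corollary3p5:
  fixes q :: "'a::field" and n k :: nat
  assumes "(2::'a) \<noteq> 0" and "q \<noteq> 0" and "0 < n" and "0 < k"
  shows "quotient_dim_eq n (Cl_ideal q n k) ((8 * k) ^ n)"
proof -
  let ?X = "{1..n} \<rightarrow>\<^sub>E indices k" and ?nw = "\<lambda>I. fword (normal_word n I) :: 'a falg"
  define B where "B = ?nw ` ?X"
  have fin: "finite B"
    unfolding B_def by (rule finite_imageI[OF finite_normal_indices])
  \<comment> \<open>Equal words take equal values at the vector separating \<open>J\<close>, which
    forces equal indices; hence \<open>B\<close> has as many elements as \<open>?X\<close>.\<close>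
  have inj: "inj_on ?nw ?X"
  proof
    fix I J assume I: "I \<in> ?X" and J: "J \<in> ?X" and "?nw I = ?nw J"
    from fun_cong[OF this(3), of "normal_word n I"] have eq: "normal_word n I = normal_word n J"
      by (simp add: fword_def split: if_splits)
    obtain h :: "'a fock" and S m where
      "\<And>I. I \<in> ?X \<Longrightarrow> act_word q k (normal_word n I) h S m \<noteq> 0 \<longleftrightarrow> I = J"
      by (rule normal_words_separated[OF assms(2) J]) blast
    then show "I = J"
      using I J eq by metis
  qed
  have sum_B: "(\<lambda>w. \<Sum>b\<in>B. c b * b w) = (\<lambda>w. \<Sum>I\<in>?X. c (?nw I) * ?nw I w)" for c
    unfolding B_def sum.reindex[OF inj] comp_def ..
  \<comment> \<open>The ideal plus the span of \<open>B\<close>, which is the subspace for which the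
    rewriting is carried out.\<close>
  define M where "M = {f. \<exists>c. fsub f (\<lambda>w. \<Sum>b\<in>B. c b * b w) \<in> Cl_ideal q n k}"
  have M_I: "f \<in> M" if "fsub f (\<lambda>w. \<Sum>b\<in>B. c b * b w) \<in> Cl_ideal q n k" for f c
    using that by (auto simp: M_def)
  interpret Cl_subspace q n k M
  proof
    show "Cl_ideal q n k \<subseteq> M"
    proof
      fix f assume "f \<in> Cl_ideal q n k"
      then show "f \<in> M" using M_I[of f "\<lambda>_. 0"] by (simp add: fsub_def)
    qed
  next
    fix f g assume "f \<in> M" "g \<in> M"
    then obtain c d where "fsub f (\<lambda>w. \<Sum>b\<in>B. c b * b w) \<in> Cl_ideal q n k"
      "fsub g (\<lambda>w. \<Sum>b\<in>B. d b * b w) \<in> Cl_ideal q n k"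
      by (auto simp: M_def)
    then have "fadd (fsub f (\<lambda>w. \<Sum>b\<in>B. c b * b w)) (fsub g (\<lambda>w. \<Sum>b\<in>B. d b * b w)) \<in> Cl_ideal q n k"
      unfolding Cl_ideal_def by (rule ideal_gen.add)
    then show "fadd f g \<in> M"
      by (intro M_I[of _ "\<lambda>b. c b + d b"]) (simp add: fadd_def fsub_def algebra_simps sum.distrib)
  next
    fix f e assume "f \<in> M"
    then obtain c where "fsub f (\<lambda>w. \<Sum>b\<in>B. c b * b w) \<in> Cl_ideal q n k"
      by (auto simp: M_def)
    then have "fsmul e (fsub f (\<lambda>w. \<Sum>b\<in>B. c b * b w)) \<in> Cl_ideal q n k"
      unfolding Cl_ideal_def by (rule ideal_gen.smul)
    then show "fsmul e f \<in> M"
      by (intro M_I[of _ "\<lambda>b. e * c b"]) (simp add: fsmul_def fsub_def algebra_simps sum_distrib_left)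
  qed (use assms in auto)
  \<comment> \<open>Index functions are unconstrained outside \<open>{1..n}\<close> in
    \<open>normal_words\<close> but extensional in \<open>?X\<close>; restricting them leaves the
    word unchanged.\<close>
  have words: "normal_words n = normal_word n ` ?X"
  proof (intro equalityI subsetI)
    fix w assume "w \<in> normal_words n"
    then obtain I where "w = normal_word n I" "\<forall>a\<in>{1..n}. I a \<in> indices k"
      by (auto simp: normal_words_def)
    then show "w \<in> normal_word n ` ?X"
      using normal_word_cong[of n I "restrict I {1..n}"]
      by (intro image_eqI[of _ _ "restrict I {1..n}"]) auto
  qed (fastforce simp: normal_words_def)
  have "fword w \<in> M" if "w \<in> normal_words n" for w
  proof (rule M_I[of _ "\<lambda>b. if b = fword w then 1 else 0"])
    have "fword w \<in> B" using that by (auto simp: words B_def)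
    then have "fsub (fword w) (\<lambda>v. \<Sum>b\<in>B. (if b = fword w then 1 else 0) * b v) = fzero"
      using fin by (simp add: fsub_def fzero_def if_distrib[of "\<lambda>x. x * _"] cong: if_cong)
    then show "fsub (fword w) (\<lambda>v. \<Sum>b\<in>B. (if b = fword w then 1 else 0) * b v) \<in> Cl_ideal q n k"
      by (simp add: Cl_ideal_def ideal_gen.zero)
  qed
  then have "\<forall>f\<in>FA n. \<exists>c. fsub f (\<lambda>w. \<Sum>b\<in>B. c b * b w) \<in> Cl_ideal q n k"
    using FA_subset by (auto simp: M_def)
  moreover have "B \<subseteq> FA n"
  proof
    fix b assume "b \<in> B"
    then obtain w where "w \<in> normal_words n" "b = fword w"
      by (auto simp: words B_def)
    then show "b \<in> FA n"
      using normal_words_letters[of w n] by (auto simp: Gens_def intro!: fword_in_FA)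
  qed
  moreover have "card B = (8 * k) ^ n"
    unfolding B_def card_image[OF inj] by (simp add: card_PiE card_indices)
  moreover have "\<forall>b\<in>B. c b = 0" if "(\<lambda>w. \<Sum>b\<in>B. c b * b w) \<in> Cl_ideal q n k" for c
    using normal_words_independent[OF assms(2) that[unfolded sum_B]] by (auto simp: B_def)
  ultimately show ?thesis
    unfolding quotient_dim_eq_def using fin by blast
qed

end
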